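(* Let $H$ be a Hamiltonian on a space of dimension at most $2^n$ ($n\ge2$) having at most $d\ge1$ nonzero entries in each column, given through the black-box function $f$ described in the context. Then there exists a decomposition $H=\sum_{j=1}^m H_j$, where each $H_j$ is a $1$-sparse Hamiltonian, such that $m=6d^2$ and each query to any $H_j$ can be simulated by making $O(\log^* n)$ queries to $H$.
   Context: A Hamiltonian is a Hermitian matrix; it is $1$-sparse if it has at most one nonzero entry in each row/column. The iterated logarithm is $\log^* n=\min\{r : \log_2^{(r)} n<2\}$, where $\log_2^{(r)}$ is the $r$-fold iterate of $\log_2$. Rows/columns of $H$ are indexed by $n$-bit integers. Black box for $H$: if the nonzero entries in column $x$ are in positions $y_1,\dots,y_{d'}$ (in arbitrary order, $d'\le d$), then $f(x,i)=(y_i,H_{x,y_i})$ for $1\le i\le d'$ and $f(x,i)=(x,0)$ for $d'<i\le d$. A query to $H$ is one evaluation of $f$. A query to $H_j$ is one evaluation of the function $g(x,j)=(y,(H_j)_{x,y})$, where $y$ is the position of the nonzero entry in column $x$ of $H_j$, with $g(x,j)=(x,0)$ if column $x$ of $H_j$ has no nonzero entry. "Simulated by making $O(\log^* n)$ queries" means that there is a procedure, independent of $H$ except through evaluations of $f$, that computes $g(x,j)$ for any given $x,j$ using at most $C\log^* n$ evaluations of $f$, where $C$ is an absolute constant. *)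

theory Defs
  imports Complex_Main "Jordan_Normal_Form.Schur_Decomposition"
begin

definition hermitian :: "complex mat \<Rightarrow> bool" where
  "hermitian A \<longleftrightarrow> square_mat A \<and> mat_adjoint A = A"

definition column_sparse :: "nat \<Rightarrow> complex mat \<Rightarrow> bool" where
  "column_sparse d A \<longleftrightarrow>
     (\<forall>x < dim_col A. card {y. y < dim_row A \<and> A $$ (y, x) \<noteq> 0} \<le> d)"

definition one_sparse :: "complex mat \<Rightarrow> bool" where
  "one_sparse A \<longleftrightarrow>
     (\<forall>x < dim_row A. card {y. y < dim_col A \<and> A $$ (x, y) \<noteq> 0} \<le> 1) \<and>
     (\<forall>x < dim_col A. card {y. y < dim_row A \<and> A $$ (y, x) \<noteq> 0} \<le> 1)"

definition log_star :: "nat \<Rightarrow> nat" where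
  "log_star n = (LEAST r. (log 2 ^^ r) (real n) < 2)"

text \<open>
  The list \<open>ys\<close> gives the positions of the nonzero entries of column \<open>x\<close> in the arbitrary order
  chosen by the black box; they are numbered from 1. The values of \<open>f\<close> on pairs \<open>(x, i)\<close> with
  \<open>x \<ge> dim_col H\<close> or \<open>i \<notin> {1..d}\<close> are left unconstrained, so a procedure that is correct for
  all such \<open>f\<close> cannot rely on them.
\<close>

definition black_box :: "(nat \<times> nat \<Rightarrow> nat \<times> complex) \<Rightarrow> nat \<Rightarrow> complex mat \<Rightarrow> bool" where
  "black_box f d H \<longleftrightarrow>
     (\<forall>x < dim_col H. \<exists>ys. distinct ys \<and>
        set ys = {y. y < dim_row H \<and> H $$ (y, x) \<noteq> 0} \<and>
        (\<forall>i \<in> {1..d}. f (x, i) =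
           (if i \<le> length ys then (ys ! (i - 1), H $$ (x, ys ! (i - 1))) else (x, 0))))"

text \<open>The function \<open>x \<mapsto> g (x, j)\<close>, for \<open>A\<close> the (1-sparse) \<open>j\<close>-th term of a decomposition.\<close>

definition one_sparse_query :: "complex mat \<Rightarrow> nat \<Rightarrow> nat \<times> complex" where
  "one_sparse_query A x =
     (if \<exists>y < dim_row A. A $$ (y, x) \<noteq> 0
      then let y = (THE y. y < dim_row A \<and> A $$ (y, x) \<noteq> 0) in (y, A $$ (x, y))
      else (x, 0))"

text \<open>
  A deterministic adaptive procedure with access to an oracle: it either halts with an output, or
  evaluates the oracle once at some argument and continues depending on the answer. The datatype
  being inductive, every run halts.
\<close>

datatype ('q, 'a, 'r) query_proc =
  Output 'r
| Ask 'q "'a \<Rightarrow> ('q, 'a, 'r) query_proc"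

primrec run :: "('q, 'a, 'r) query_proc \<Rightarrow> ('q \<Rightarrow> 'a) \<Rightarrow> 'r" where
  "run (Output r) f = r"
| "run (Ask q k) f = run (k (f q)) f"

primrec num_queries :: "('q, 'a, 'r) query_proc \<Rightarrow> ('q \<Rightarrow> 'a) \<Rightarrow> nat" where
  "num_queries (Output r) f = 0"
| "num_queries (Ask q k) f = Suc (num_queries (k (f q)) f)"

end

theory Submission
  imports Defs
begin

text \<open>
  Give the entry \<open>H\<^sub>x\<^sub>y\<close> with \<open>x \<le> y\<close> the label \<open>(a, b)\<close> if \<open>y\<close> is the \<open>a\<close>-th neighbour of \<open>x\<close>
  and \<open>x\<close> is the \<open>b\<close>-th neighbour of \<open>y\<close>. For a fixed label every vertex has at most one successor
  and at most one predecessor, both found with two oracle evaluations, so the off-diagonal entries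
  form disjoint increasing paths; a vertex with a diagonal entry of that label has no other one.
  The vertices of these paths are coloured by the deterministic coin tossing of Cole and Vishkin:
  a vertex replaces its colour by the position of the lowest bit in which it differs from the
  colour of its successor, together with that bit. This keeps the
  colouring proper and turns \<open>B\<close>-bit colours into colours below \<open>2 * B\<close>, so \<open>log* n + 3\<close> rounds
  suffice to go from the \<open>n\<close>-bit vertex names to six colours. Splitting each label class by the
  colour of the smaller endpoint yields the \<open>6 * d\<^sup>2\<close> one-sparse terms, and the colour of a vertex
  after \<open>k\<close> rounds depends only on the next \<open>k\<close> vertices of its path.
\<close>

section \<open>Sequential composition of query procedures\<close>

primrec bind :: "('q, 'a, 'r) query_proc \<Rightarrow> ('r \<Rightarrow> ('q, 'a, 's) query_proc) \<Rightarrow> ('q, 'a, 's) query_proc"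
  where
  "bind (Output r) g = g r"
| "bind (Ask q k) g = Ask q (\<lambda>a. bind (k a) g)"

lemma run_bind [simp]: "run (bind p g) f = run (g (run p f)) f"
  by (induction p) auto

lemma num_queries_bind [simp]:
  "num_queries (bind p g) f = num_queries p f + num_queries (g (run p f)) f"
  by (induction p) auto

section \<open>One round of colour reduction\<close>

text \<open>The pair of position and bit is coded as one number. The end of a path has no successor
  to differ from and uses position 0.\<close>

definition cv_step :: "nat \<Rightarrow> nat option \<Rightarrow> nat" where
  "cv_step a b =
     (let p = (case b of None \<Rightarrow> 0 | Some b \<Rightarrow> LEAST p. bit a p \<noteq> bit b p)
      in 2 * p + of_bool (bit a p))"

lemma bit_Least_diff:
  fixes a b :: nat
  assumes "a \<noteq> b"
  shows "bit a (LEAST p. bit a p \<noteq> bit b p) \<noteq> bit b (LEAST p. bit a p \<noteq> bit b p)"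
proof -
  have "\<exists>p. bit a p \<noteq> bit b p"
    using assms by (auto simp: bit_eq_iff)
  then show ?thesis by (rule LeastI_ex)
qed

text \<open>Equal codes would mean equal positions and equal bits there, whereas \<open>a\<close>
  and \<open>b\<close> differ at the position chosen for \<open>a\<close>. This works for any
  position chosen for \<open>b\<close>, so \<open>b\<close> may be the end of a path.\<close>

lemma cv_step_neq:
  assumes "a \<noteq> b"
  shows "cv_step a (Some b) \<noteq> cv_step b c"
proof
  define p where "p = (LEAST p. bit a p \<noteq> bit b p)"
  define q where "q = (case c of None \<Rightarrow> 0 | Some c \<Rightarrow> LEAST q. bit b q \<noteq> bit c q)"
  assume "cv_step a (Some b) = cv_step b c"
  then have *: "2 * p + of_bool (bit a p) = 2 * q + (of_bool (bit b q) :: nat)"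
    unfolding cv_step_def p_def q_def Let_def option.case .
  have "m = n \<and> u = v" if "2 * m + of_bool u = 2 * n + (of_bool v :: nat)" for m n u v
    using that by (cases u; cases v) (simp_all, presburger+)
  from this[OF *] have "bit a p = bit b p" by metis
  with bit_Least_diff[OF assms] show False by (simp add: p_def)
qed

text \<open>Distinct \<open>B\<close>-bit numbers differ at some position below \<open>B\<close>,
  and the end of a path uses position \<open>0 < B\<close>. So the code is at most
  \<open>2 * (B - 1) + 1\<close>.\<close>

lemma cv_step_less:
  assumes "a < 2 ^ B" "0 < B" "\<And>b. c = Some b \<Longrightarrow> b < 2 ^ B \<and> a \<noteq> b"
  shows "cv_step a c < 2 * B"
proof -
  define p where "p = (case c of None \<Rightarrow> 0 | Some b \<Rightarrow> LEAST p. bit a p \<noteq> bit b p)"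
  have "p < B"
  proof (cases c)
    case (Some b)
    have "\<not> bit m k" if "m < 2 ^ B" "B \<le> k" for m k :: nat
    proof -
      have "m < 2 ^ k"
        using that by (meson le_less_trans less_le_trans one_le_numeral power_increasing)
      then show ?thesis by (simp add: bit_iff_odd)
    qed
    moreover have "bit a p \<noteq> bit b p"
      using bit_Least_diff[of a b] assms(3)[OF Some] by (simp add: p_def Some)
    ultimately show ?thesis
      using assms(1) assms(3)[OF Some] by (meson not_le)
  qed (use assms in \<open>simp add: p_def\<close>)
  moreover have "cv_step a c \<le> 2 * p + 1"
    unfolding cv_step_def Let_def p_def[symmetric] by simp
  ultimately show ?thesis by linarith
qed

fun colour :: "(nat \<Rightarrow> nat option) \<Rightarrow> nat \<Rightarrow> nat \<Rightarrow> nat" where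
  "colour s 0 v = v"
| "colour s (Suc m) v = cv_step (colour s m v) (map_option (colour s m) (s v))"

lemma colour_neq:
  assumes "\<And>v w. s v = Some w \<Longrightarrow> v \<noteq> w" "s v = Some w"
  shows "colour s m v \<noteq> colour s m w"
  using assms(2)
  by (induction m arbitrary: v w) (auto simp: assms(1) intro!: cv_step_neq simp del: not_None_eq)

text \<open>\<open>V\<close> is closed under successors because the bound for \<open>v\<close>
  relies on the bound for the old colour of its successor.\<close>

lemma colour_Suc_less:
  assumes "\<And>v w. s v = Some w \<Longrightarrow> v \<noteq> w" "\<And>v w. v \<in> V \<Longrightarrow> s v = Some w \<Longrightarrow> w \<in> V"
    and "\<And>v. v \<in> V \<Longrightarrow> colour s m v < 2 ^ B" "0 < B" "v \<in> V"
  shows "colour s (Suc m) v < 2 * B"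
  unfolding colour.simps
proof (rule cv_step_less)
  fix b assume "map_option (colour s m) (s v) = Some b"
  then obtain w where "s v = Some w" "b = colour s m w" by auto
  then show "b < 2 ^ B \<and> colour s m v \<noteq> b"
    using assms(2,3,5) colour_neq[of s v w m, OF assms(1)] by blast
qed (use assms in auto)

section \<open>The iterated logarithm and the number of rounds\<close>

lemma funpow_log_ge_2:
  assumes "k < log_star n"
  shows "2 \<le> (log 2 ^^ k) (real n)"
  using not_less_Least[OF assms[unfolded log_star_def]] by simp

lemma log2_le_minus_1:
  assumes "2 \<le> (x :: real)"
  shows "log 2 x \<le> x - 1"
proof -
  \<comment> \<open>The bound \<open>ln y \<le> y - 1\<close> at \<open>y = 1 / 2\<close> reads
    \<open>- ln 2 \<le> - 1 / 2\<close>.\<close>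
  have "1 / 2 \<le> ln (2 :: real)"
    using ln_le_minus_one[of "1 / 2 :: real"] by (simp add: ln_div)
  moreover have "ln (x / 2) \<le> x / 2 - 1"
    using assms by (intro ln_le_minus_one) auto
  moreover have "x / 2 - 1 = (x - 2) * (1 / 2)"
    by (simp add: field_simps)
  moreover have "(x - 2) * (1 / 2) \<le> (x - 2) * ln 2"
    using assms calculation(1) by (intro mult_left_mono) auto
  ultimately have "ln x \<le> (x - 1) * ln 2"
    using assms by (simp add: ln_div left_diff_distrib)
  then show ?thesis using assms by (simp add: log_def divide_le_eq)
qed

text \<open>The \<open>LEAST\<close> in \<open>log_star\<close> is meaningful only if some iterate
  drops below 2. One does, since each logarithm takes at least 1 off a value that is still at least
  2.\<close>

lemma funpow_log_star_less:
  "(log 2 ^^ log_star n) (real n) < 2"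
proof -
  have *: "\<exists>r. (log 2 ^^ r) x < 2" if "x < real m + 2" for m and x :: real
    using that
  proof (induction m arbitrary: x)
    case 0
    then show ?case by (intro exI[of _ 0]) simp
  next
    case (Suc m)
    show ?case
    proof (cases "x < 2")
      case True
      then show ?thesis by (intro exI[of _ 0]) simp
    next
      case False
      then have "log 2 x \<le> x - 1" by (intro log2_le_minus_1) simp
      with Suc have "log 2 x < real m + 2" by simp
      from Suc.IH[OF this] obtain r where "(log 2 ^^ r) (log 2 x) < 2" by blast
      then have "(log 2 ^^ Suc r) x < 2" by (simp add: funpow_swap1)
      then show ?thesis by blast
    qed
  qed
  have "\<exists>r. (log 2 ^^ r) (real n) < 2" by (rule *[of _ n]) simp
  then show ?thesis unfolding log_star_def by (rule LeastI_ex)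
qed

text \<open>Allows additive constants in the query count to be absorbed into a multiple of
  \<open>log_star n\<close>.\<close>

lemma log_star_pos:
  assumes "2 \<le> n"
  shows "0 < log_star n"
proof (rule ccontr)
  assume "\<not> 0 < log_star n"
  then have "log_star n = 0" by simp
  with funpow_log_star_less[of n] assms show False by simp
qed

text \<open>Colours after \<open>k\<close> rounds fit into \<open>B\<close> bits, where
  \<open>B\<close> exceeds the \<open>k\<close>-th iterated logarithm by at most 4. The bound 6 is
  where the estimate stalls: 3 bits give 6 colours, which again take 3 bits.\<close>

lemma colour_log_star_less_6:
  assumes "\<And>v w. s v = Some w \<Longrightarrow> v \<noteq> w" "\<And>v w. v \<in> V \<Longrightarrow> s v = Some w \<Longrightarrow> w \<in> V"
    and "\<And>v. v \<in> V \<Longrightarrow> v < 2 ^ n" "0 < n" "v \<in> V"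
  shows "colour s (log_star n + 3) v < 6"
proof -
  have step: "colour s (Suc m) v < 2 * B"
    if "\<And>v. v \<in> V \<Longrightarrow> colour s m v < 2 ^ B" "0 < B" "v \<in> V" for m B v
    using colour_Suc_less[of s V m B v] assms(1,2) that by blast
  let ?L = "\<lambda>k. (log 2 ^^ k) (real n)"
  \<comment> \<open>The slack 4 is preserved because \<open>1 + \<lceil>log 2 B\<rceil> \<le> 2 + log 2 (L + 4) \<le> 4 + log 2 L\<close> for \<open>L \<ge> 2\<close>.\<close>
  have "\<exists>B>0. real B \<le> ?L k + 4 \<and> (\<forall>v\<in>V. colour s k v < 2 ^ B)" if "k \<le> log_star n" for k
    using that
  proof (induction k)
    case 0
    then show ?case using assms by (intro exI[of _ n]) auto
  next
    case (Suc k)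
    then obtain B where B: "0 < B" "real B \<le> ?L k + 4" "\<And>v. v \<in> V \<Longrightarrow> colour s k v < 2 ^ B"
      by auto
    have L: "2 \<le> ?L k" using Suc.prems by (intro funpow_log_ge_2) simp
    \<comment> \<open>The new colours lie below \<open>2 * B\<close> and so fit into
      \<open>b + 1\<close> bits, \<open>b\<close> being the least exponent with
      \<open>B \<le> 2 ^ b\<close>.\<close>
    define b where "b = nat \<lceil>log 2 (real B)\<rceil>"
    have "0 \<le> log 2 (real B)" using B(1) by simp
    then have b: "real b < log 2 (real B) + 1" "log 2 (real B) \<le> real b"
      unfolding b_def by linarith+
    have "log 2 (real B) \<le> log 2 (2 ^ 2 * ?L k)"
      using B L by (subst log_le_cancel_iff) auto
    also have "\<dots> = 2 + ?L (Suc k)"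
      using L log_pow_cancel[of "2::real" 2] by (subst log_mult) auto
    finally have "real (b + 1) \<le> ?L (Suc k) + 4"
      using b by simp
    moreover have "real B \<le> 2 powr real b"
      using b(2) B(1) by (simp add: log_le_iff)
    then have "real B \<le> real (2 ^ b)" by (simp add: powr_realpow)
    then have "B \<le> 2 ^ b" by (simp only: of_nat_le_iff)
    then have "2 * B \<le> 2 ^ (b + 1)" by simp
    then have "\<forall>v\<in>V. colour s (Suc k) v < 2 ^ (b + 1)"
      using step[of k B] B(1,3) by (meson less_le_trans)
    ultimately show ?case by (intro exI[of _ "b + 1"]) simp
  qed
  from this[of "log_star n"] obtain B
    where B: "0 < B" "real B \<le> ?L (log_star n) + 4" "\<And>v. v \<in> V \<Longrightarrow> colour s (log_star n) v < 2 ^ B"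
    by auto
  \<comment> \<open>The last iterate is below 2, hence \<open>B < 6\<close>. Three more rounds bound
    the colours by 10, then 8, then 6.\<close>
  have "B \<le> 5" using B(2) funpow_log_star_less[of n] by linarith
  then have "colour s (Suc (log_star n)) v < 2 ^ 4" if "v \<in> V" for v
    using step[of "log_star n" B v] B(1,3) that by simp
  from step[OF this] have "colour s (Suc (Suc (log_star n))) v < 2 ^ 3" if "v \<in> V" for v
    using that by simp
  from step[OF this] have "colour s (Suc (Suc (Suc (log_star n)))) v < 2 * 3" if "v \<in> V" for v
    using that by simp
  from this[OF assms(5)] show ?thesis by (simp add: numeral_3_eq_3 del: colour.simps)
qed

section \<open>Query procedures for neighbours, colours and terms\<close>

text \<open>Testing the values against 0 discards the padding answers \<open>(x, 0)\<close>, which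
  would otherwise look like diagonal entries.\<close>

definition nbr :: "(nat \<times> nat \<Rightarrow> nat \<times> complex) \<Rightarrow> nat \<Rightarrow> nat \<Rightarrow> nat \<Rightarrow> (nat \<times> complex) option" where
  "nbr f a b x =
     (let (y, h) = f (x, a); (z, h') = f (y, b)
      in if h \<noteq> 0 \<and> h' \<noteq> 0 \<and> z = x then Some (y, h) else None)"

definition nbr_proc ::
  "nat \<Rightarrow> nat \<Rightarrow> nat \<Rightarrow> (nat \<times> nat, nat \<times> complex, (nat \<times> complex) option) query_proc" where
  "nbr_proc a b x =
     Ask (x, a) (\<lambda>(y, h). Ask (y, b) (\<lambda>(z, h').
       Output (if h \<noteq> 0 \<and> h' \<noteq> 0 \<and> z = x then Some (y, h) else None)))"

lemma run_nbr_proc [simp]: "run (nbr_proc a b x) f = nbr f a b x"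
  by (simp add: nbr_proc_def nbr_def split: prod.split)

lemma num_queries_nbr_proc [simp]: "num_queries (nbr_proc a b x) f = 2"
  by (simp add: nbr_proc_def split: prod.split)

text \<open>Yields the successor on an increasing path. Strictness keeps a diagonal entry from
  making a vertex its own successor.\<close>

definition up :: "nat \<Rightarrow> (nat \<times> complex) option \<Rightarrow> nat option" where
  "up x r = (case r of Some (y, h) \<Rightarrow> if x < y then Some y else None | None \<Rightarrow> None)"

lemma up_eq_Some_iff: "up x r = Some y \<longleftrightarrow> x < y \<and> (\<exists>h. r = Some (y, h))"
  by (auto simp: up_def split: option.splits if_splits)

text \<open>
  The procedure returns the colours of \<open>x\<close> after all rounds \<open>m \<le> k\<close> at once: unfolding the recursion
  of \<open>colour\<close> directly would take exponentially many queries.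
\<close>

fun colour_proc ::
  "nat \<Rightarrow> nat \<Rightarrow> nat \<Rightarrow> nat \<Rightarrow> (nat \<times> nat, nat \<times> complex, nat \<Rightarrow> nat) query_proc" where
  "colour_proc a b 0 x = Output (\<lambda>m. x)"
| "colour_proc a b (Suc k) x =
     bind (nbr_proc a b x) (\<lambda>r. case up x r of
         None \<Rightarrow> Output (rec_nat x (\<lambda>m c. cv_step c None))
       | Some y \<Rightarrow> bind (colour_proc a b k y) (\<lambda>g.
           Output (rec_nat x (\<lambda>m c. cv_step c (Some (g m))))))"

lemma num_queries_colour_proc: "num_queries (colour_proc a b k x) f \<le> 2 * k"
  by (induction k arbitrary: x) (auto split: option.split)

text \<open>Round \<open>m + 1\<close> at \<open>x\<close> reads only round \<open>m\<close> at the
  successor, so the successor's colours up to round \<open>k\<close> determine those of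
  \<open>x\<close> up to round \<open>k + 1\<close>.\<close>

lemma run_colour_proc:
  "m \<le> k \<Longrightarrow> run (colour_proc a b k x) f m = colour (\<lambda>v. up v (nbr f a b v)) m x"
proof (induction k arbitrary: x m)
  case (Suc k)
  show ?case
  proof (cases "up x (nbr f a b x)")
    case None
    then show ?thesis by (simp, induction m) auto
  next
    case (Some y)
    have "rec_nat x (\<lambda>m c. cv_step c (Some (run (colour_proc a b k y) f m))) m =
        colour (\<lambda>v. up v (nbr f a b v)) m x"
      using Suc.prems by (induction m) (auto simp: Some Suc.IH)
    then show ?thesis by (simp add: Some)
  qed
qed simp

text \<open>Tries \<open>x\<close> as the smaller endpoint first, then as the larger one. In the
  second case the label seen from \<open>x\<close> is \<open>(b, a)\<close> and the colour to
  compare is that of the other endpoint; if there is none, the second colour run starts at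
  \<open>x\<close> as a dummy.\<close>

definition query_term ::
  "nat \<Rightarrow> nat \<Rightarrow> nat \<Rightarrow> nat \<Rightarrow> nat \<Rightarrow> (nat \<times> nat, nat \<times> complex, nat \<times> complex) query_proc" where
  "query_term k a b c x =
     bind (nbr_proc a b x) (\<lambda>r. bind (nbr_proc b a x) (\<lambda>s.
     bind (colour_proc a b k x) (\<lambda>g. bind (colour_proc a b k (case s of None \<Rightarrow> x | Some (y, h) \<Rightarrow> y)) (\<lambda>g'.
     Output
       (case r of
         Some (y, h) \<Rightarrow> if x \<le> y \<and> g k = c then (y, h) else
           (case s of Some (y, h) \<Rightarrow> if y \<le> x \<and> g' k = c then (y, h) else (x, 0) | None \<Rightarrow> (x, 0))
       | None \<Rightarrow>
           (case s of Some (y, h) \<Rightarrow> if y \<le> x \<and> g' k = c then (y, h) else (x, 0) | None \<Rightarrow> (x, 0)))))))"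

lemma num_queries_query_term: "num_queries (query_term k a b c x) f \<le> 4 * k + 4"
  using num_queries_colour_proc[of a b k x f]
    num_queries_colour_proc[of a b k "case nbr f b a x of None \<Rightarrow> x | Some (y, h) \<Rightarrow> y" f]
  by (simp add: query_term_def)

section \<open>Label and colour classes as one-sparse matrices\<close>

text \<open>Replaces the list behind the black box by its effect: the nonzero answers at
  \<open>x\<close> enumerate the nonzero entries of row \<open>x\<close>, each once.\<close>

locale hermitian_oracle =
  fixes N d :: nat and H :: "complex mat" and f :: "nat \<times> nat \<Rightarrow> nat \<times> complex"
  assumes oracle_range:
      "x < N \<Longrightarrow> a \<in> {1..d} \<Longrightarrow> f (x, a) = (y, h) \<Longrightarrow> h \<noteq> 0 \<Longrightarrow> y < N \<and> h = H $$ (x, y)"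
    and oracle_inj:
      "x < N \<Longrightarrow> a \<in> {1..d} \<Longrightarrow> a' \<in> {1..d} \<Longrightarrow> f (x, a) = (y, h) \<Longrightarrow> f (x, a') = (y, h) \<Longrightarrow>
        h \<noteq> 0 \<Longrightarrow> a = a'"
    and oracle_surj:
      "x < N \<Longrightarrow> y < N \<Longrightarrow> H $$ (x, y) \<noteq> 0 \<Longrightarrow> \<exists>a\<in>{1..d}. f (x, a) = (y, H $$ (x, y))"
    and entry_cnj: "x < N \<Longrightarrow> y < N \<Longrightarrow> H $$ (y, x) = cnj (H $$ (x, y))"
begin

definition path_colour :: "nat \<Rightarrow> nat \<Rightarrow> nat \<Rightarrow> nat \<Rightarrow> nat" where
  "path_colour k a b x = colour (\<lambda>v. up v (nbr f a b v)) k x"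

lemma entry_0_iff: "x < N \<Longrightarrow> y < N \<Longrightarrow> H $$ (y, x) = 0 \<longleftrightarrow> H $$ (x, y) = 0"
  using entry_cnj[of x y] by simp

lemma nbr_eq_Some_iff:
  assumes "x < N" "a \<in> {1..d}" "b \<in> {1..d}"
  shows "nbr f a b x = Some (y, h) \<longleftrightarrow>
    y < N \<and> h = H $$ (x, y) \<and> h \<noteq> 0 \<and> f (x, a) = (y, h) \<and> f (y, b) = (x, H $$ (y, x))"
proof
  assume "nbr f a b x = Some (y, h)"
  then obtain h' where *: "f (x, a) = (y, h)" "f (y, b) = (x, h')" "h \<noteq> 0" "h' \<noteq> 0"
    by (auto simp: nbr_def split: prod.splits if_splits)
  moreover have "y < N \<and> h = H $$ (x, y)" using oracle_range[of x a y h] assms * by blast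
  moreover from this have "h' = H $$ (y, x)" using oracle_range[of y b x h'] assms * by blast
  ultimately show "y < N \<and> h = H $$ (x, y) \<and> h \<noteq> 0 \<and> f (x, a) = (y, h) \<and> f (y, b) = (x, H $$ (y, x))"
    by simp
next
  assume "y < N \<and> h = H $$ (x, y) \<and> h \<noteq> 0 \<and> f (x, a) = (y, h) \<and> f (y, b) = (x, H $$ (y, x))"
  then show "nbr f a b x = Some (y, h)"
    using entry_0_iff[of x y] assms by (auto simp: nbr_def)
qed

text \<open>Reading an edge from its other end exchanges the two numbers of its label, so
  predecessors are found by \<open>nbr f b a\<close>.\<close>

lemma nbr_swap:
  assumes "x < N" "a \<in> {1..d}" "b \<in> {1..d}" "y < N"
  shows "nbr f b a y = Some (x, H $$ (y, x)) \<longleftrightarrow> nbr f a b x = Some (y, H $$ (x, y))"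
  using assms entry_0_iff[of x y] by (auto simp: nbr_eq_Some_iff)

text \<open>Label and colour belong to the smaller endpoint, but both cases look the edge up from
  \<open>x\<close>, the vertex given in a query.\<close>

definition in_term :: "nat \<Rightarrow> nat \<Rightarrow> nat \<Rightarrow> nat \<Rightarrow> nat \<Rightarrow> nat \<Rightarrow> bool" where
  "in_term k a b c x y \<longleftrightarrow>
     x \<le> y \<and> nbr f a b x = Some (y, H $$ (x, y)) \<and> path_colour k a b x = c \<or>
     y \<le> x \<and> nbr f b a x = Some (y, H $$ (x, y)) \<and> path_colour k a b y = c"

lemma in_term_commute:
  assumes "a \<in> {1..d}" "b \<in> {1..d}" "x < N" "y < N"
  shows "in_term k a b c x y \<longleftrightarrow> in_term k a b c y x"
  using assms nbr_swap[of x a b y] nbr_swap[of x b a y] by (auto simp: in_term_def)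

lemma in_term_imp:
  assumes "a \<in> {1..d}" "b \<in> {1..d}" "x < N" "in_term k a b c x y"
  shows "y < N" "H $$ (x, y) \<noteq> 0"
  using assms by (auto simp: in_term_def nbr_eq_Some_iff)

text \<open>Two neighbours on the same side of \<open>x\<close> agree because the label determines
  them. On opposite sides, \<open>x\<close> would be the path successor of \<open>z\<close> with the
  same colour, against \<open>colour_neq\<close>; if \<open>z = x\<close>, the diagonal entry itself
  is the neighbour labelled \<open>(a, b)\<close>.\<close>

lemma in_term_unique:
  assumes "a \<in> {1..d}" "b \<in> {1..d}" "x < N" "in_term k a b c x y" "in_term k a b c x z"
  shows "y = z"
proof -
  have *: "y = z"
    if y: "x \<le> y" "nbr f a b x = Some (y, H $$ (x, y))" "path_colour k a b x = c"
      and z: "z \<le> x" "nbr f b a x = Some (z, H $$ (x, z))" "path_colour k a b z = c" for y z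
  proof (cases "z = x")
    case True
    with z assms have "nbr f a b x = Some (x, H $$ (x, x))" using nbr_swap[of x a b x] by simp
    with y True show ?thesis by simp
  next
    case False
    have "z < N" using z(1) assms by simp
    with z assms have "nbr f a b z = Some (x, H $$ (z, x))" using nbr_swap[of z a b x] by simp
    with False z(1) have "up z (nbr f a b z) = Some x" by (simp add: up_eq_Some_iff)
    then have "path_colour k a b z \<noteq> path_colour k a b x"
      unfolding path_colour_def by (intro colour_neq) (auto simp: up_eq_Some_iff)
    with y z show ?thesis by simp
  qed
  from assms(4,5) show ?thesis
    unfolding in_term_def using *[of y z] *[of z y] by auto
qed

text \<open>Injectivity of the oracle recovers the label from the edge and its direction, and the
  smaller endpoint then fixes the colour. Only a diagonal entry can satisfy different cases of the
  two memberships; its label has \<open>a = b\<close>.\<close>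

lemma in_term_inj:
  assumes "a \<in> {1..d}" "b \<in> {1..d}" "a' \<in> {1..d}" "b' \<in> {1..d}" "x < N"
    and "in_term k a b c x y" "in_term k a' b' c' x y"
  shows "a = a' \<and> b = b' \<and> c = c'"
proof -
  have ab: "a = a' \<and> b = b'"
    if "nbr f a b x = Some (y, H $$ (x, y))" "nbr f a' b' x = Some (y, H $$ (x, y))"
      "a \<in> {1..d}" "b \<in> {1..d}" "a' \<in> {1..d}" "b' \<in> {1..d}" for a b a' b' y
  proof -
    from that assms(5) have "y < N" "H $$ (x, y) \<noteq> 0"
      "f (x, a) = (y, H $$ (x, y))" "f (y, b) = (x, H $$ (y, x))"
      "f (x, a') = (y, H $$ (x, y))" "f (y, b') = (x, H $$ (y, x))"
      by (auto simp: nbr_eq_Some_iff)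
    moreover from this have "H $$ (y, x) \<noteq> 0" using entry_0_iff[of x y] assms(5) by simp
    ultimately show ?thesis using oracle_inj assms(5) that by metis
  qed
  \<comment> \<open>A diagonal entry read from its other end is the same entry, so it carries both
    \<open>(a, b)\<close> and \<open>(b, a)\<close>.\<close>
  have loop: "a = b" if "nbr f a b x = Some (x, H $$ (x, x))" "a \<in> {1..d}" "b \<in> {1..d}" for a b
    using that ab[of a b x b a] nbr_swap[of x a b x] assms(5) by blast
  from assms(6,7) show ?thesis
    unfolding in_term_def
  proof (elim disjE conjE)
    assume "nbr f a b x = Some (y, H $$ (x, y))" "nbr f a' b' x = Some (y, H $$ (x, y))"
      "path_colour k a b x = c" "path_colour k a' b' x = c'"
    then show ?thesis using ab assms(1-4) by blast
  next
    assume "nbr f b a x = Some (y, H $$ (x, y))" "nbr f b' a' x = Some (y, H $$ (x, y))"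
      "path_colour k a b y = c" "path_colour k a' b' y = c'"
    then show ?thesis using ab assms(1-4) by blast
  next
    assume "x \<le> y" "y \<le> x"
      and *: "nbr f a b x = Some (y, H $$ (x, y))" "nbr f b' a' x = Some (y, H $$ (x, y))"
      and c: "path_colour k a b x = c" "path_colour k a' b' y = c'"
    then have [simp]: "y = x" by simp
    have "a = b'" "b = a'" "a = b" using ab[OF *] loop * assms(1-4) by simp_all
    with c show ?thesis by simp
  next
    assume "x \<le> y" "y \<le> x"
      and *: "nbr f b a x = Some (y, H $$ (x, y))" "nbr f a' b' x = Some (y, H $$ (x, y))"
      and c: "path_colour k a b y = c" "path_colour k a' b' x = c'"
    then have [simp]: "y = x" by simp
    have "a = b'" "b = a'" "b = a" using ab[OF *] loop * assms(1-4) by simp_all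
    with c show ?thesis by simp
  qed
qed

lemma ex_in_term:
  assumes "x < N" "y < N" "H $$ (x, y) \<noteq> 0"
  shows "\<exists>a\<in>{1..d}. \<exists>b\<in>{1..d}. in_term k a b (path_colour k a b (min x y)) x y"
proof -
  obtain a b where ab: "a \<in> {1..d}" "b \<in> {1..d}"
    "f (x, a) = (y, H $$ (x, y))" "f (y, b) = (x, H $$ (y, x))"
    using oracle_surj[of x y] oracle_surj[of y x] entry_0_iff[of x y] assms by metis
  then have "nbr f a b x = Some (y, H $$ (x, y))" using assms by (simp add: nbr_eq_Some_iff)
  \<comment> \<open>Which order of the label applies depends on which endpoint is smaller.\<close>
  then have "in_term k a b (path_colour k a b (min x y)) x y \<or>
      in_term k b a (path_colour k b a (min x y)) x y"
    by (cases "x \<le> y") (auto simp: in_term_def min_def)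
  with ab show ?thesis by blast
qed

definition term_mat :: "nat \<Rightarrow> nat \<Rightarrow> nat \<Rightarrow> nat \<Rightarrow> complex mat" where
  "term_mat k a b c = mat N N (\<lambda>(x, y). if in_term k a b c x y then H $$ (x, y) else 0)"

lemma term_mat_carrier: "term_mat k a b c \<in> carrier_mat N N"
  by (simp add: term_mat_def)

lemma term_mat_entry:
  "x < N \<Longrightarrow> y < N \<Longrightarrow> term_mat k a b c $$ (x, y) = (if in_term k a b c x y then H $$ (x, y) else 0)"
  by (simp add: term_mat_def)

lemma term_mat_entry_neq_0_iff:
  assumes "a \<in> {1..d}" "b \<in> {1..d}" "x < N" "y < N"
  shows "term_mat k a b c $$ (x, y) \<noteq> 0 \<longleftrightarrow> in_term k a b c x y"
    and "term_mat k a b c $$ (y, x) \<noteq> 0 \<longleftrightarrow> in_term k a b c x y"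
  using assms in_term_imp(2)[of a b x k c y] in_term_imp(2)[of a b y k c x] in_term_commute[of a b x y k c]
  by (auto simp: term_mat_entry)

lemma one_sparse_term_mat:
  assumes "a \<in> {1..d}" "b \<in> {1..d}"
  shows "one_sparse (term_mat k a b c)"
proof -
  have "card {y. y < N \<and> in_term k a b c x y} \<le> 1" if "x < N" for x
  proof -
    have "\<exists>z. {y. y < N \<and> in_term k a b c x y} \<subseteq> {z}"
      using in_term_unique[OF assms that] by blast
    then show ?thesis by (metis card_mono finite.simps is_singletonI is_singleton_altdef)
  qed
  moreover have "{y. y < N \<and> term_mat k a b c $$ (x, y) \<noteq> 0} = {y. y < N \<and> in_term k a b c x y}"
    "{y. y < N \<and> term_mat k a b c $$ (y, x) \<noteq> 0} = {y. y < N \<and> in_term k a b c x y}" if "x < N" for x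
    using term_mat_entry_neq_0_iff[OF assms that] by blast+
  ultimately show ?thesis
    using term_mat_carrier[of k a b c] by (simp add: one_sparse_def)
qed

section \<open>Correctness of the query procedure\<close>

lemma run_query_term_in_term:
  assumes "a \<in> {1..d}" "b \<in> {1..d}" "x < N" "in_term k a b c x y"
  shows "run (query_term k a b c x) f = (y, H $$ (x, y))"
\<comment> \<open>The split follows the order of the tests in \<open>query_term\<close>; a success
  of the first test with some \<open>z\<close> forces \<open>z = y\<close> by uniqueness.\<close>
proof (cases "\<exists>z. x \<le> z \<and> nbr f a b x = Some (z, H $$ (x, z)) \<and> path_colour k a b x = c")
  case True
  then obtain z where z: "x \<le> z" "nbr f a b x = Some (z, H $$ (x, z))" "path_colour k a b x = c"
    by blast
  then have "in_term k a b c x z" by (simp add: in_term_def)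
  then have "z = y" using in_term_unique assms by blast
  then show ?thesis
    using z by (simp add: query_term_def run_colour_proc path_colour_def)
next
  case False
  then have "y \<le> x" "nbr f b a x = Some (y, H $$ (x, y))" "path_colour k a b y = c"
    using assms(4) by (auto simp: in_term_def)
  moreover have "h = H $$ (x, z)" if "nbr f a b x = Some (z, h)" for z h
    using that nbr_eq_Some_iff assms by blast
  ultimately show ?thesis
    using False by (auto simp: query_term_def run_colour_proc path_colour_def split: option.splits)
qed

lemma run_query_term_none:
  assumes "a \<in> {1..d}" "b \<in> {1..d}" "x < N" "\<And>y. \<not> in_term k a b c x y"
  shows "run (query_term k a b c x) f = (x, 0)"
proof -
  have "h = H $$ (x, z)" if "nbr f a b x = Some (z, h) \<or> nbr f b a x = Some (z, h)" for z h
    using that nbr_eq_Some_iff assms by blast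
  then show ?thesis
    using assms(4)
    by (fastforce simp: query_term_def run_colour_proc path_colour_def in_term_def split: option.splits)
qed

lemma run_query_term:
  assumes "a \<in> {1..d}" "b \<in> {1..d}" "x < N"
  shows "run (query_term k a b c x) f = one_sparse_query (term_mat k a b c) x"
proof (cases "\<exists>y. in_term k a b c x y")
  case True
  then obtain y where y: "in_term k a b c x y" by blast
  then have "y < N" using in_term_imp assms by blast
  \<comment> \<open>Evaluates the \<open>THE\<close> over column \<open>x\<close> to
    \<open>y\<close>; symmetry of \<open>in_term\<close> lets the column be read as a row.\<close>
  moreover have iff: "z < N \<and> term_mat k a b c $$ (z, x) \<noteq> 0 \<longleftrightarrow> z = y" for z
    using term_mat_entry_neq_0_iff(2)[OF assms, of z k c] in_term_unique[OF assms y, of z]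
      in_term_imp(1)[OF assms y] y by blast
  ultimately show ?thesis
    using run_query_term_in_term[OF assms y] term_mat_carrier[of k a b c] assms y
    by (simp add: one_sparse_query_def iff term_mat_entry Bex_def)
next
  case False
  then show ?thesis
    using run_query_term_none[OF assms, of k c] term_mat_entry_neq_0_iff(2)[OF assms, of _ k c]
      term_mat_carrier[of k a b c]
    by (auto simp: one_sparse_query_def)
qed

lemma path_colour_less_6:
  assumes "a \<in> {1..d}" "b \<in> {1..d}" "x < N" "N \<le> 2 ^ n" "0 < n"
  shows "path_colour (log_star n + 3) a b x < 6"
  unfolding path_colour_def
proof (rule colour_log_star_less_6[where V = "{..<N}"])
  show "w \<in> {..<N}" if "v \<in> {..<N}" "up v (nbr f a b v) = Some w" for v w
    using that nbr_eq_Some_iff[of v a b w] assms by (auto simp: up_eq_Some_iff)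
qed (use assms in \<open>auto simp: up_eq_Some_iff\<close>)

end

section \<open>From the matrix and its black box to the locale\<close>

lemma hermitian_iff:
  assumes "A \<in> carrier_mat N N"
  shows "hermitian A \<longleftrightarrow> (\<forall>x<N. \<forall>y<N. A $$ (y, x) = cnj (A $$ (x, y)))"
proof -
  have adj: "mat_adjoint A \<in> carrier_mat N N"
    "\<And>x y. x < N \<Longrightarrow> y < N \<Longrightarrow> mat_adjoint A $$ (x, y) = cnj (A $$ (y, x))"
    using assms by (auto simp: mat_adjoint_def mat_of_rows_def)
  show ?thesis
  proof
    assume "hermitian A"
    then have "mat_adjoint A = A" by (simp add: hermitian_def)
    then show "\<forall>x<N. \<forall>y<N. A $$ (y, x) = cnj (A $$ (x, y))" using adj(2) by metis
  next
    assume *: "\<forall>x<N. \<forall>y<N. A $$ (y, x) = cnj (A $$ (x, y))"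
    have "mat_adjoint A = A"
    proof (intro eq_matI)
      fix x y assume "x < dim_row A" "y < dim_col A"
      then have "x < N" "y < N" using assms by auto
      then have "A $$ (x, y) = cnj (A $$ (y, x))" using * by blast
      with \<open>x < N\<close> \<open>y < N\<close> show "mat_adjoint A $$ (x, y) = A $$ (x, y)"
        using adj(2) by metis
    qed (use assms adj(1) in auto)
    then show "hermitian A" using assms by (simp add: hermitian_def)
  qed
qed

lemma (in hermitian_oracle) hermitian_term_mat:
  assumes "a \<in> {1..d}" "b \<in> {1..d}"
  shows "hermitian (term_mat k a b c)"
  unfolding hermitian_iff[OF term_mat_carrier]
  using in_term_commute[OF assms] by (auto simp: term_mat_entry intro: entry_cnj)

text \<open>Column sparsity bounds the list of positions by \<open>d\<close>, so the indices
  \<open>1\<close> to \<open>d\<close> reach every nonzero entry.\<close>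

lemma hermitian_oracleI:
  assumes H: "H \<in> carrier_mat N N" and "hermitian H" "column_sparse d H" "black_box f d H"
  shows "hermitian_oracle N d H f"
proof -
  have dim: "dim_row H = N" "dim_col H = N" using H by auto
  have cnj: "H $$ (y, x) = cnj (H $$ (x, y))" if "x < N" "y < N" for x y
    using assms(2) that unfolding hermitian_iff[OF H] by blast
  have ex: "\<exists>ys. distinct ys \<and> length ys \<le> d \<and> set ys = {y. y < N \<and> H $$ (x, y) \<noteq> 0} \<and>
      (\<forall>i \<in> {1..d}. f (x, i) = (if i \<le> length ys then (ys ! (i - 1), H $$ (x, ys ! (i - 1))) else (x, 0)))"
    if x: "x < N" for x
  proof -
    \<comment> \<open>The black box lists the support of column \<open>x\<close> but reports values
      from row \<open>x\<close>; hermiticity makes the two supports agree.\<close>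
    have eq: "{y. y < N \<and> H $$ (y, x) \<noteq> 0} = {y. y < N \<and> H $$ (x, y) \<noteq> 0}"
    proof -
      have "H $$ (y, x) = 0 \<longleftrightarrow> H $$ (x, y) = 0" if "y < N" for y
        using cnj[OF x that] by simp
      then show ?thesis by blast
    qed
    from assms(4) x obtain ys where ys: "distinct ys" "set ys = {y. y < N \<and> H $$ (y, x) \<noteq> 0}"
      "\<forall>i \<in> {1..d}. f (x, i) = (if i \<le> length ys then (ys ! (i - 1), H $$ (x, ys ! (i - 1))) else (x, 0))"
      unfolding black_box_def dim by blast
    moreover have "card (set ys) \<le> d"
      using assms(3) x dim ys(2) by (simp add: column_sparse_def)
    then have "length ys \<le> d" using ys(1) by (simp add: distinct_card)
    ultimately show ?thesis unfolding eq by blast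
  qed
  show ?thesis
  proof
    fix x a y h assume *: "x < N" "a \<in> {1..d}" "f (x, a) = (y, h)" "h \<noteq> 0"
    from ex[OF *(1)] obtain ys where ys: "set ys = {y. y < N \<and> H $$ (x, y) \<noteq> 0}"
      "f (x, a) = (if a \<le> length ys then (ys ! (a - 1), H $$ (x, ys ! (a - 1))) else (x, 0))"
      using *(2) by blast
    with * have "a - 1 < length ys" "y = ys ! (a - 1)" "h = H $$ (x, y)"
      by (auto split: if_splits)
    then show "y < N \<and> h = H $$ (x, y)" using ys(1) nth_mem[of "a - 1" ys] by auto
  next
    fix x a a' y h
    assume *: "x < N" "a \<in> {1..d}" "a' \<in> {1..d}" "f (x, a) = (y, h)" "f (x, a') = (y, h)" "h \<noteq> 0"
    from ex[OF *(1)] obtain ys where ys: "distinct ys"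
      "\<forall>i\<in>{1..d}. f (x, i) = (if i \<le> length ys then (ys ! (i - 1), H $$ (x, ys ! (i - 1))) else (x, 0))"
      by blast
    with * have "a - 1 < length ys" "a' - 1 < length ys" "ys ! (a - 1) = ys ! (a' - 1)"
      by (force split: if_splits)+
    with ys(1) have "a - 1 = a' - 1" by (simp add: nth_eq_iff_index_eq)
    with *(2,3) show "a = a'" by (simp add: eq_diff_iff)
  next
    fix x y assume *: "x < N" "y < N" "H $$ (x, y) \<noteq> 0"
    from ex[OF *(1)] obtain ys where ys: "length ys \<le> d" "set ys = {y. y < N \<and> H $$ (x, y) \<noteq> 0}"
      "\<forall>i\<in>{1..d}. f (x, i) = (if i \<le> length ys then (ys ! (i - 1), H $$ (x, ys ! (i - 1))) else (x, 0))"
      by blast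
    with * have "y \<in> set ys" by simp
    then obtain i where "i < length ys" "y = ys ! i" by (metis in_set_conv_nth)
    then show "\<exists>a\<in>{1..d}. f (x, a) = (y, H $$ (x, y))"
      using ys by (intro bexI[of _ "i + 1"]) auto
  qed (rule cnj)
qed

section \<open>Numbering the terms and summing them\<close>

text \<open>Mixed-radix digits of \<open>j - 1 = c + 6 * ((a - 1) + d * (b - 1))\<close>; labels
  count from 1, colours from 0.\<close>

definition term_label :: "nat \<Rightarrow> nat \<Rightarrow> nat \<times> nat \<times> nat" where
  "term_label d j = (Suc ((j - 1) div 6 mod d), Suc ((j - 1) div 6 div d), (j - 1) mod 6)"

lemma bij_betw_term_label:
  "bij_betw (term_label d) {1..6 * d\<^sup>2} ({1..d} \<times> {1..d} \<times> {..<6})"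
proof (rule bij_betw_byWitness[where f' = "\<lambda>(a, b, c). Suc (c + 6 * ((a - 1) + d * (b - 1)))"])
  show "\<forall>j\<in>{1..6 * d\<^sup>2}. (\<lambda>(a, b, c). Suc (c + 6 * ((a - 1) + d * (b - 1)))) (term_label d j) = j"
  proof
    fix j assume "j \<in> {1..6 * d\<^sup>2}"
    have "(j - 1) div 6 mod d + d * ((j - 1) div 6 div d) = (j - 1) div 6" by simp
    then have "(\<lambda>(a, b, c). Suc (c + 6 * ((a - 1) + d * (b - 1)))) (term_label d j) =
        Suc ((j - 1) mod 6 + 6 * ((j - 1) div 6))"
      unfolding term_label_def prod.case diff_Suc_1 by presburger
    also have "\<dots> = j" using \<open>j \<in> _\<close> by simp
    finally show "(\<lambda>(a, b, c). Suc (c + 6 * ((a - 1) + d * (b - 1)))) (term_label d j) = j" .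
  qed
  show "\<forall>t\<in>{1..d} \<times> {1..d} \<times> {..<6}.
      term_label d ((\<lambda>(a, b, c). Suc (c + 6 * ((a - 1) + d * (b - 1)))) t) = t"
  proof safe
    fix a b c :: nat assume *: "a \<in> {1..d}" "b \<in> {1..d}" "c < 6"
    have 1: "(c + 6 * m) div 6 = m \<and> (c + 6 * m) mod 6 = c" for m
      using *(3) by simp
    have 2: "((a - 1) + d * m) div d = m \<and> ((a - 1) + d * m) mod d = a - 1" for m
    proof -
      have "a - 1 < d" using *(1) by auto
      then show ?thesis by simp
    qed
    show "term_label d (Suc (c + 6 * ((a - 1) + d * (b - 1)))) = (a, b, c)"
      using *(1,2)
      by (simp only: term_label_def diff_Suc_1 1[THEN conjunct1] 1[THEN conjunct2]
          2[THEN conjunct1] 2[THEN conjunct2]) simp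
  qed
  show "term_label d ` {1..6 * d\<^sup>2} \<subseteq> {1..d} \<times> {1..d} \<times> {..<6}"
  proof (rule image_subsetI)
    fix j assume "j \<in> {1..6 * d\<^sup>2}"
    then have "(j - 1) div 6 < d * d" by (auto simp: power2_eq_square less_mult_imp_div_less)
    then have "(j - 1) div 6 div d < d" "0 < d"
      by (auto simp: less_mult_imp_div_less intro: gr0I)
    then show "term_label d j \<in> {1..d} \<times> {1..d} \<times> {..<6}"
      by (simp add: term_label_def Suc_le_eq)
  qed
  show "(\<lambda>(a, b, c). Suc (c + 6 * ((a - 1) + d * (b - 1)))) ` ({1..d} \<times> {1..d} \<times> {..<6}) \<subseteq> {1..6 * d\<^sup>2}"
  proof safe
    fix a b c :: nat assume *: "a \<in> {1..d}" "b \<in> {1..d}" "c < 6"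
    have "(a - 1) + d * (b - 1) < d + d * (b - 1)" using * by auto
    also have "\<dots> = d * b" using * by (cases b) auto
    also have "\<dots> \<le> d\<^sup>2" using * by (simp add: power2_eq_square)
    finally show "Suc (c + 6 * ((a - 1) + d * (b - 1))) \<in> {1..6 * d\<^sup>2}" using *(3) by simp
  qed
qed

lemma term_label_range:
  assumes "j \<in> {1..6 * d\<^sup>2}" "term_label d j = (a, b, c)"
  shows "a \<in> {1..d}" "b \<in> {1..d}"
  using bij_betw_apply[OF bij_betw_term_label assms(1)] assms(2) by auto

text \<open>Exactly one term contains a given nonzero entry: \<open>ex_in_term\<close> provides it,
  \<open>in_term_inj\<close> excludes others, and the colour bound 6 puts its index in
  range.\<close>

lemma (in hermitian_oracle) sum_term_mat:
  assumes "x < N" "y < N" "N \<le> 2 ^ n" "0 < n"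
  shows "(\<Sum>j = 1..6 * d\<^sup>2. (case term_label d j of (a, b, c) \<Rightarrow> term_mat (log_star n + 3) a b c) $$ (x, y))
    = H $$ (x, y)"
proof -
  let ?k = "log_star n + 3"
  have "(\<Sum>j = 1..6 * d\<^sup>2. (case term_label d j of (a, b, c) \<Rightarrow> term_mat ?k a b c) $$ (x, y)) =
      (\<Sum>(a, b, c) \<in> {1..d} \<times> {1..d} \<times> {..<6}. term_mat ?k a b c $$ (x, y))"
    unfolding sum.reindex_bij_betw[OF bij_betw_term_label, symmetric]
    by (intro sum.cong) (auto split: prod.split)
  also have "\<dots> = H $$ (x, y)"
  proof (cases "H $$ (x, y) = 0")
    case True
    with assms show ?thesis by (auto simp: term_mat_entry intro!: sum.neutral)
  next
    case False
    then obtain a b where ab: "a \<in> {1..d}" "b \<in> {1..d}"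
      and t: "in_term ?k a b (path_colour ?k a b (min x y)) x y"
      using ex_in_term assms by blast
    let ?t = "(a, b, path_colour ?k a b (min x y))"
    have "(\<Sum>(a, b, c) \<in> {1..d} \<times> {1..d} \<times> {..<6}. term_mat ?k a b c $$ (x, y)) =
        (\<Sum>t \<in> {1..d} \<times> {1..d} \<times> {..<6}. if t = ?t then H $$ (x, y) else 0)"
    proof (intro sum.cong refl, clarify)
      fix a' b' c' assume "a' \<in> {1..d}" "b' \<in> {1..d}"
      then have "in_term ?k a' b' c' x y \<longleftrightarrow> (a', b', c') = ?t"
        using in_term_inj[OF _ _ ab assms(1) _ t] t by blast
      then show "term_mat ?k a' b' c' $$ (x, y) = (if (a', b', c') = ?t then H $$ (x, y) else 0)"
        using assms by (simp only: term_mat_entry)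
    qed
    also have "\<dots> = H $$ (x, y)"
      using path_colour_less_6[OF ab _ assms(3,4), of "min x y"] assms ab by (subst sum.delta) auto
    finally show ?thesis .
  qed
  finally show ?thesis .
qed

theorem lemma2:
  shows "\<exists>(C :: real)
           (P :: nat \<Rightarrow> nat \<Rightarrow> nat \<Rightarrow> nat \<Rightarrow> (nat \<times> nat, nat \<times> complex, nat \<times> complex) query_proc).
         \<forall>(n :: nat) (d :: nat) (N :: nat) (H :: complex mat) (f :: nat \<times> nat \<Rightarrow> nat \<times> complex).
           n \<ge> 2 \<longrightarrow> d \<ge> 1 \<longrightarrow> N \<le> 2 ^ n \<longrightarrow>
           H \<in> carrier_mat N N \<longrightarrow> hermitian H \<longrightarrow> column_sparse d H \<longrightarrow> black_box f d H \<longrightarrow>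
           (\<exists>Hs :: nat \<Rightarrow> complex mat.
              (\<forall>j \<in> {1..6 * d\<^sup>2}. Hs j \<in> carrier_mat N N \<and> hermitian (Hs j) \<and> one_sparse (Hs j)) \<and>
              H = mat N N (\<lambda>(x, y). \<Sum>j = 1..6 * d\<^sup>2. Hs j $$ (x, y)) \<and>
              (\<forall>x < N. \<forall>j \<in> {1..6 * d\<^sup>2}.
                 run (P n d x j) f = one_sparse_query (Hs j) x \<and>
                 real (num_queries (P n d x j) f) \<le> C * real (log_star n)))"
proof -
  \<comment> \<open>Only \<open>n\<close>, \<open>d\<close>, \<open>x\<close> and \<open>j\<close>
    enter, so one procedure serves every \<open>H\<close> and \<open>f\<close>.\<close>
  define P where
    "P n d x j = (case term_label d j of (a, b, c) \<Rightarrow> query_term (log_star n + 3) a b c x)" for n d x j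
  show ?thesis
  proof (intro exI[of _ 20] exI[of _ P] allI impI)
    fix n d N :: nat and H :: "complex mat" and f :: "nat \<times> nat \<Rightarrow> nat \<times> complex"
    assume *: "2 \<le> n" "N \<le> 2 ^ n"
      and H: "H \<in> carrier_mat N N" "hermitian H" "column_sparse d H" "black_box f d H"
    interpret hermitian_oracle N d H f by (rule hermitian_oracleI[OF H])
    define Hs where "Hs j = (case term_label d j of (a, b, c) \<Rightarrow> term_mat (log_star n + 3) a b c)" for j
    have "Hs j \<in> carrier_mat N N \<and> hermitian (Hs j) \<and> one_sparse (Hs j)" if "j \<in> {1..6 * d\<^sup>2}" for j
      using term_mat_carrier hermitian_term_mat one_sparse_term_mat term_label_range[OF that]
      by (simp add: Hs_def split: prod.split)
    moreover have "H = mat N N (\<lambda>(x, y). \<Sum>j = 1..6 * d\<^sup>2. Hs j $$ (x, y))"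
      using H(1) sum_term_mat[OF _ _ *(2)] *(1) by (intro eq_matI) (auto simp: Hs_def)
    moreover have "run (P n d x j) f = one_sparse_query (Hs j) x" if "x < N" "j \<in> {1..6 * d\<^sup>2}" for x j
      using run_query_term[OF _ _ that(1)] term_label_range[OF that(2)]
      by (simp add: Hs_def P_def split: prod.split)
    moreover have "real (num_queries (P n d x j) f) \<le> 20 * real (log_star n)" for x j
    proof -
      have "num_queries (P n d x j) f \<le> 4 * (log_star n + 3) + 4"
        using num_queries_query_term[of "log_star n + 3"] by (simp add: P_def split: prod.split)
      \<comment> \<open>The count \<open>4 * log_star n + 16\<close> is at most
        \<open>20 * log_star n\<close> since \<open>log_star n \<ge> 1\<close>.\<close>
      then have "num_queries (P n d x j) f \<le> 20 * log_star n"
        using log_star_pos[OF *(1)] by (cases "log_star n") auto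
      then show ?thesis by (metis of_nat_le_iff of_nat_mult of_nat_numeral)
    qed
    ultimately show "\<exists>Hs.
        (\<forall>j \<in> {1..6 * d\<^sup>2}. Hs j \<in> carrier_mat N N \<and> hermitian (Hs j) \<and> one_sparse (Hs j)) \<and>
        H = mat N N (\<lambda>(x, y). \<Sum>j = 1..6 * d\<^sup>2. Hs j $$ (x, y)) \<and>
        (\<forall>x < N. \<forall>j \<in> {1..6 * d\<^sup>2}.
           run (P n d x j) f = one_sparse_query (Hs j) x \<and>
           real (num_queries (P n d x j) f) \<le> 20 * real (log_star n))"
      by (intro exI[of _ Hs]) blast
  qed
qed

end
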